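(* There exists no globally smooth strong generalized almost complex structure on $\mathbb{S}^6$ that can be obtained by gluing locally flat models defined over the standard two-chart stereographic cover using $b$-field transforms.
   Context: For a manifold $M$, $E=TM\oplus T^*M$ carries the pairing $\langle X+\xi,Y+\eta\rangle=\iota_X\eta+\iota_Y\xi$. A strong generalized almost complex structure is a bundle endomorphism $\mathfrak{J}$ of $E$ with $\mathfrak{J}^2=-\mathrm{Id}$ and $\langle\mathfrak{J}v,\mathfrak{J}w\rangle=\langle v,w\rangle$; in block form $\begin{pmatrix}H&\alpha\\\beta&K\end{pmatrix}$ with $H:TM\to TM$, $\alpha:T^*M\to TM$, $\beta:TM\to T^*M$, $K:T^*M\to T^*M$. For a closed $2$-form $b$ the $b$-field transform is $e^b(X+\xi)=X+\xi+\iota_Xb$. The standard two-chart stereographic cover of $\mathbb{S}^6$ consists of the northern chart $U_N\cong\mathbb{R}^6$ (coordinate $x$) and the southern chart $U_S\cong\mathbb{R}^6$ (coordinate $y$), with transition map $x=\phi(y)=y/|y|^2$, $y\neq0$. A locally flat model is a strong generalized almost complex structure $\mathfrak{J}_N$ on the chart $U_N$ whose blocks $H_N,\alpha_N,\beta_N,K_N$ are constant matrices in the coordinate $x$. Gluing using $b$-field transforms means that on $U_N\cap U_S$ the structure on the southern chart is $\mathfrak{J}_S=e^b(\phi_*\mathfrak{J}_N)e^{-b}$ for a smooth $b$-field transform $e^b$, where $\phi_*\mathfrak{J}_N$ is $\mathfrak{J}_N$ transported to the coordinate $y$ by the differential of $\phi$; the resulting structure is globally smooth if $\mathfrak{J}_S$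 extends smoothly over the south pole $y=0$ (no constancy of $\mathfrak{J}_S$ is required). *)

theory Defs
  imports "HOL-Analysis.Analysis"
begin

section \<open>Smooth maps\<close>

text \<open>These are meant for open sets \<open>S\<close> only; all derivatives are full (not relative) ones.\<close>

primrec Ck_on :: "nat \<Rightarrow> 'a::euclidean_space set \<Rightarrow> ('a \<Rightarrow> 'b::real_normed_vector) \<Rightarrow> bool" where
  "Ck_on 0 S f \<longleftrightarrow> continuous_on S f"
| "Ck_on (Suc k) S f \<longleftrightarrow>
     (\<forall>x\<in>S. f differentiable (at x)) \<and>
     (\<forall>v. Ck_on k S (\<lambda>x. frechet_derivative f (at x) v))"

definition smooth_on :: "'a::euclidean_space set \<Rightarrow> ('a \<Rightarrow> 'b::real_normed_vector) \<Rightarrow> bool" where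
  "smooth_on S f \<longleftrightarrow> (\<forall>k. Ck_on k S f)"


section \<open>The generalized tangent bundle of a six-dimensional chart\<close>

text \<open>
  Over a coordinate domain the fibre of \<open>TM \<oplus> T*M\<close> is a pair \<open>(X, \<xi>)\<close> of coefficient
  vectors with respect to the coordinate frame and its dual coframe; hence the evaluation
  of the covector \<open>\<eta>\<close> on \<open>X\<close> is the standard inner product \<open>X \<bullet> \<eta>\<close>.
  A bundle endomorphism is a function of the coordinate whose values are linear maps of this fibre.
\<close>

type_synonym fibre = "(real^6) \<times> (real^6)"

definition pairing :: "fibre \<Rightarrow> fibre \<Rightarrow> real" where
  "pairing v w = fst v \<bullet> snd w + fst w \<bullet> snd v"

definition strong_gacs :: "(fibre \<Rightarrow> fibre) \<Rightarrow> bool" where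
  "strong_gacs J \<longleftrightarrow> linear J \<and> (\<forall>v. J (J v) = - v) \<and>
     (\<forall>v w. pairing (J v) (J w) = pairing v w)"

definition smooth_strong_gacs_on :: "(real^6) set \<Rightarrow> (real^6 \<Rightarrow> fibre \<Rightarrow> fibre) \<Rightarrow> bool" where
  "smooth_strong_gacs_on S J \<longleftrightarrow>
     (\<forall>x\<in>S. strong_gacs (J x)) \<and> (\<forall>v. smooth_on S (\<lambda>x. J x v))"

definition block_map ::
  "real^6^6 \<Rightarrow> real^6^6 \<Rightarrow> real^6^6 \<Rightarrow> real^6^6 \<Rightarrow> fibre \<Rightarrow> fibre" where
  "block_map H \<alpha> \<beta> K = (\<lambda>(X, \<xi>). (H *v X + \<alpha> *v \<xi>, \<beta> *v X + K *v \<xi>))"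

definition constant_blocks_on :: "(real^6) set \<Rightarrow> (real^6 \<Rightarrow> fibre \<Rightarrow> fibre) \<Rightarrow> bool" where
  "constant_blocks_on S J \<longleftrightarrow> (\<exists>H \<alpha> \<beta> K. \<forall>x\<in>S. J x = block_map H \<alpha> \<beta> K)"

definition locally_flat_model_on :: "(real^6) set \<Rightarrow> (real^6 \<Rightarrow> fibre \<Rightarrow> fibre) \<Rightarrow> bool" where
  "locally_flat_model_on S J \<longleftrightarrow> smooth_strong_gacs_on S J \<and> constant_blocks_on S J"


section \<open>Closed two-forms and b-field transforms\<close>

text \<open>
  A two-form is given by its skew coefficient matrix, \<open>b(X, Y) = \<Sum>i j. b $ i $ j * X $ i * Y $ j\<close>,
  so that the covector \<open>\<iota>\<^sub>X b = b(X, -)\<close> has coefficient vector \<open>X v* b\<close>.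
\<close>

definition two_form_on :: "(real^6) set \<Rightarrow> (real^6 \<Rightarrow> real^6^6) \<Rightarrow> bool" where
  "two_form_on S b \<longleftrightarrow> smooth_on S b \<and> (\<forall>y\<in>S. transpose (b y) = - b y)"

definition partial :: "6 \<Rightarrow> (real^6 \<Rightarrow> real) \<Rightarrow> real^6 \<Rightarrow> real" where
  "partial i f y = frechet_derivative f (at y) (axis i 1)"

definition closed_two_form_on :: "(real^6) set \<Rightarrow> (real^6 \<Rightarrow> real^6^6) \<Rightarrow> bool" where
  "closed_two_form_on S b \<longleftrightarrow> two_form_on S b \<and>
     (\<forall>y\<in>S. \<forall>i j k. partial i (\<lambda>z. b z $ j $ k) y + partial j (\<lambda>z. b z $ k $ i) y
                      + partial k (\<lambda>z. b z $ i $ j) y = 0)"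

definition b_transform :: "real^6^6 \<Rightarrow> fibre \<Rightarrow> fibre" where
  "b_transform B = (\<lambda>(X, \<xi>). (X, \<xi> + X v* B))"


section \<open>Transport along a change of coordinates\<close>

text \<open>
  For \<open>x = \<phi>(y)\<close> with Jacobian \<open>D\<close> at \<open>y\<close>, vectors go from the \<open>y\<close>- to the \<open>x\<close>-frame by \<open>D\<close> and
  covectors by the inverse transpose of \<open>D\<close>. Conjugating with this map expresses a structure given
  in the coordinate \<open>x\<close> in the coordinate \<open>y\<close>.
\<close>

definition jacobian :: "(real^6 \<Rightarrow> real^6) \<Rightarrow> real^6 \<Rightarrow> real^6^6" where
  "jacobian \<phi> y = matrix (frechet_derivative \<phi> (at y))"

definition frame_change :: "(real^6 \<Rightarrow> real^6) \<Rightarrow> real^6 \<Rightarrow> fibre \<Rightarrow> fibre" where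
  "frame_change \<phi> y =
     (\<lambda>(X, \<xi>). (jacobian \<phi> y *v X, transpose (matrix_inv (jacobian \<phi> y)) *v \<xi>))"

definition transport ::
  "(real^6 \<Rightarrow> real^6) \<Rightarrow> (real^6 \<Rightarrow> fibre \<Rightarrow> fibre) \<Rightarrow> real^6 \<Rightarrow> fibre \<Rightarrow> fibre" where
  "transport \<phi> J y = inv (frame_change \<phi> y) \<circ> J (\<phi> y) \<circ> frame_change \<phi> y"


section \<open>The stereographic cover of the six-sphere\<close>

text \<open>
  The sphere is the unit sphere of \<open>\<real>\<^sup>7\<close>, written as \<open>\<real>\<^sup>6 \<times> \<real>\<close>. The northern chart domain contains the
  north pole (the origin of the coordinate \<open>x\<close>) and omits the south pole, and vice versa.
\<close>

definition S6 :: "((real^6) \<times> real) set" where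
  "S6 = sphere 0 1"

definition U_N :: "((real^6) \<times> real) set" where
  "U_N = S6 - {(0, -1)}"

definition U_S :: "((real^6) \<times> real) set" where
  "U_S = S6 - {(0, 1)}"

definition chart_N :: "(real^6) \<times> real \<Rightarrow> real^6" where
  "chart_N = (\<lambda>(u, t). (1 / (1 + t)) *\<^sub>R u)"

definition chart_S :: "(real^6) \<times> real \<Rightarrow> real^6" where
  "chart_S = (\<lambda>(u, t). (1 / (1 - t)) *\<^sub>R u)"

definition transition :: "real^6 \<Rightarrow> real^6" where
  "transition y = chart_N (inv_into U_S chart_S y)"

definition glued_by_b_field ::
  "(real^6 \<Rightarrow> fibre \<Rightarrow> fibre) \<Rightarrow> (real^6 \<Rightarrow> real^6^6) \<Rightarrow> (real^6 \<Rightarrow> fibre \<Rightarrow> fibre) \<Rightarrow> bool" where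
  "glued_by_b_field J_N b J_S \<longleftrightarrow>
     closed_two_form_on (chart_S ` (U_N \<inter> U_S)) b \<and>
     (\<forall>y \<in> chart_S ` (U_N \<inter> U_S).
        J_S y = b_transform (b y) \<circ> transport transition J_N y \<circ> b_transform (- b y))"


text \<open>Sanity checks: the charts are onto, the overlap is the punctured space in the coordinate \<open>y\<close>,
  and the transition map is the inversion.\<close>

lemma S6_iff: "(u, t) \<in> S6 \<longleftrightarrow> (norm u)\<^sup>2 + t\<^sup>2 = 1"
  by (simp add: S6_def norm_Pair)

lemma chart_S_inverse:
  fixes y :: "real^6"
  defines "p \<equiv> ((2 / ((norm y)\<^sup>2 + 1)) *\<^sub>R y, ((norm y)\<^sup>2 - 1) / ((norm y)\<^sup>2 + 1))"
  shows "p \<in> U_S" "chart_S p = y" "y \<noteq> 0 \<Longrightarrow> p \<in> U_N"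
    "y \<noteq> 0 \<Longrightarrow> chart_N p = (1 / (norm y)\<^sup>2) *\<^sub>R y"
proof -
  let ?n = "(norm y)\<^sup>2"
  have n: "?n + 1 > 0" by (simp add: add_nonneg_pos)
  have "p \<in> S6"
    unfolding p_def S6_iff using n
    by (simp add: power_mult_distrib power_divide divide_simps)
       (simp add: power2_eq_square algebra_simps)
  moreover have "snd p \<noteq> 1" using n by (simp add: p_def divide_simps)
  ultimately show "p \<in> U_S" by (auto simp: U_S_def)
  have "1 - (?n - 1) / (?n + 1) = 2 / (?n + 1)" using n by (simp add: divide_simps)
  then show "chart_S p = y" using n by (simp add: chart_S_def p_def)
  assume y: "y \<noteq> 0"
  have "snd p \<noteq> -1" using n y by (simp add: p_def divide_simps)
  with \<open>p \<in> S6\<close> show "p \<in> U_N" by (auto simp: U_N_def)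
  have "1 + (?n - 1) / (?n + 1) = 2 * ?n / (?n + 1)" using n by (simp add: divide_simps)
  then show "chart_N p = (1 / ?n) *\<^sub>R y" using n y by (simp add: chart_N_def p_def)
qed

lemma snd_U_S: "p \<in> U_S \<Longrightarrow> snd p < 1"
proof -
  assume p: "p \<in> U_S"
  obtain u t where [simp]: "p = (u, t)" by (cases p)
  have e: "(norm u)\<^sup>2 + t\<^sup>2 = 1" and ne: "(u, t) \<noteq> (0, 1)" using p by (auto simp: U_S_def S6_iff)
  then have "t\<^sup>2 \<le> 1" by (metis le_add_same_cancel2 zero_le_power2)
  then have "t \<le> 1" by (simp add: power2_le_iff_abs_le abs_square_le_1)
  moreover have "t \<noteq> 1" using e ne by auto
  ultimately show ?thesis by simp
qed

lemma inj_on_chart_S: "inj_on chart_S U_S"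
proof -
  have "p = ((2 / ((norm y)\<^sup>2 + 1)) *\<^sub>R y, ((norm y)\<^sup>2 - 1) / ((norm y)\<^sup>2 + 1))"
    if p: "p \<in> U_S" and y: "y = chart_S p" for p y
  proof -
    obtain u t where [simp]: "p = (u, t)" by (cases p)
    have t: "t < 1" using snd_U_S[OF p] by simp
    have e: "(norm u)\<^sup>2 = (1 - t) * (1 + t)"
      using p by (auto simp: U_S_def S6_iff algebra_simps power2_eq_square)
    have yu: "y = (1 / (1 - t)) *\<^sub>R u" by (simp add: y chart_S_def)
    have "(norm y)\<^sup>2 = (norm u)\<^sup>2 / (1 - t)\<^sup>2"
      by (simp add: yu power_mult_distrib power_divide)
    then have ny: "(norm y)\<^sup>2 = (1 + t) / (1 - t)"
      using t unfolding e by (simp add: power2_eq_square)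
    have s: "(norm y)\<^sup>2 + 1 = 2 / (1 - t)" using t by (simp add: ny divide_simps)
    have d: "(norm y)\<^sup>2 - 1 = 2 * t / (1 - t)" using t by (simp add: ny divide_simps)
    show ?thesis using t by (simp add: s d) (simp add: yu)
  qed
  then show ?thesis unfolding inj_on_def by metis
qed

lemma chart_S_image: "chart_S ` U_S = UNIV"
  using chart_S_inverse(1,2) by (metis UNIV_eq_I imageI)

lemma chart_N_image: "chart_N ` U_N = UNIV"
proof -
  have "x \<in> chart_N ` U_N" for x
  proof -
    obtain u t where p: "(u, t) \<in> U_S" "chart_S (u, t) = x"
      using chart_S_image by (metis UNIV_I imageE surj_pair)
    then have "(u, -t) \<in> U_N" by (auto simp: U_N_def U_S_def S6_iff)
    moreover have "chart_N (u, -t) = x" using p(2) by (simp add: chart_N_def chart_S_def)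
    ultimately show ?thesis by (metis imageI)
  qed
  then show ?thesis by auto
qed

lemma overlap_image: "chart_S ` (U_N \<inter> U_S) = - {0}"
proof
  show "- {0} \<subseteq> chart_S ` (U_N \<inter> U_S)"
  proof
    fix y :: "real^6" assume "y \<in> - {0}"
    then have "y \<noteq> 0" by simp
    then show "y \<in> chart_S ` (U_N \<inter> U_S)"
      using chart_S_inverse[of y] by (metis IntI imageI)
  qed
  show "chart_S ` (U_N \<inter> U_S) \<subseteq> - {0}"
  proof clarsimp
    fix u t assume N: "(u, t) \<in> U_N" and S: "(u, t) \<in> U_S" and "chart_S (u, t) = 0"
    moreover have "t < 1" using snd_U_S[OF S] by simp
    ultimately have u: "u = 0" by (simp add: chart_S_def)
    then have "t\<^sup>2 = 1" using S by (simp add: U_S_def S6_iff)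
    then have "t = 1 \<or> t = -1" by (simp add: power2_eq_1_iff)
    then show False using N S u by (auto simp: U_N_def U_S_def)
  qed
qed

lemma transition_eq:
  assumes "y \<noteq> 0"
  shows "transition y = (1 / (norm y)\<^sup>2) *\<^sub>R y"
  using chart_S_inverse[of y] inv_into_f_f[OF inj_on_chart_S] assms
  unfolding transition_def by metis

end

theory Submission
  imports Defs
begin

text \<open>
  Let \<open>y = s u\<close> with \<open>u\<close> a unit vector, and let \<open>R\<^sub>u\<close> be the reflection in \<open>u\<^sup>\<bottom>\<close>; the inversion has
  Jacobian \<open>s\<^sup>-\<^sup>2 R\<^sub>u\<close> at \<open>y\<close>. Since b-field transforms do not change the \<open>\<alpha>\<close> block, the \<open>\<alpha>\<close> block of
  \<open>J_S\<close> at \<open>y\<close> is \<open>s\<^sup>4 R\<^sub>u \<alpha> R\<^sub>u\<close>, which vanishes at the south pole. Hence the \<open>H\<close> block \<open>P\<close> of \<open>J_S\<close> at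
  the pole satisfies \<open>P\<^sup>2 = -1\<close>. The product of the \<open>H\<close> and \<open>\<alpha>\<close> blocks is skew at every point; dividing
  by \<open>s\<^sup>4\<close> and letting \<open>s \<rightarrow> 0\<close>, \<open>P R\<^sub>u \<alpha> R\<^sub>u\<close> is skew for every \<open>u\<close>. Choosing \<open>u \<bottom> x\<close>,
  a vector \<open>x\<close> with \<open>\<alpha> x \<noteq> 0\<close> would make \<open>x\<^sup>\<bottom>\<close> invariant under \<open>P\<close>, so that \<open>P\<close> would have a real
  eigenvalue; therefore \<open>\<alpha> = 0\<close>. Now b-field transforms do not change the \<open>H\<close> block either, so
  \<open>P = R\<^sub>u H R\<^sub>u\<close> for every \<open>u\<close>, which forces \<open>H\<close> to have a real eigenvector, against \<open>H\<^sup>2 = -1\<close>.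
\<close>

section \<open>Complex structures on Euclidean space\<close>

lemma linear_complex_structure_no_eigenvector:
  fixes P :: "'a::real_vector \<Rightarrow> 'a"
  assumes "linear P" and "\<And>v. P (P v) = - v" and "P x = c *\<^sub>R x"
  shows "x = 0"
proof -
  have "(c * c + 1) *\<^sub>R x = 0"
    using assms(2)[of x] assms(3) by (simp add: linear_scale[OF assms(1)] algebra_simps)
  moreover have "c * c + 1 > 0" by (simp add: add_nonneg_pos)
  ultimately show ?thesis by auto
qed

text \<open>On the one-dimensional quotient by an invariant hyperplane, \<open>P\<close> would act
  as multiplication by a real \<open>c\<close> with \<open>c * c = -1\<close>.\<close>

lemma linear_complex_structure_no_invariant_hyperplane:
  fixes P :: "'a::real_inner \<Rightarrow> 'a"
  assumes "linear P" and "\<And>v. P (P v) = - v" and inv: "\<And>w. w \<bullet> x = 0 \<Longrightarrow> P w \<bullet> x = 0"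
  shows "x = 0"
proof (rule ccontr)
  assume x: "x \<noteq> 0"
  define c where "c = (P x \<bullet> x) / (x \<bullet> x)"
  define w where "w = P x - c *\<^sub>R x"
  have "w \<bullet> x = 0" using x by (simp add: w_def c_def inner_diff_left)
  then have "P w \<bullet> x = 0" by (rule inv)
  moreover have "P w = - x - c *\<^sub>R P x"
    by (simp add: w_def linear_diff[OF assms(1)] linear_scale[OF assms(1)] assms(2))
  moreover have "P x \<bullet> x = c * (x \<bullet> x)" using x by (simp add: c_def)
  ultimately have "(1 + c * c) * (x \<bullet> x) = 0"
    by (simp add: inner_diff_left algebra_simps)
  moreover have "1 + c * c > 0" by (simp add: add_pos_nonneg)
  ultimately show False using x by simp
qed

text \<open>Supplies a reflection that fixes two prescribed vectors at once.\<close>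

lemma exists_unit_orthogonal_to_pair:
  fixes a b :: "'a::euclidean_space"
  assumes "DIM('a) > 2"
  obtains u where "norm u = 1" "u \<bullet> a = 0" "u \<bullet> b = 0"
proof -
  have "dim {a, b} \<le> card {a, b}" by (rule dim_le_card') simp
  also have "\<dots> \<le> 2" by (simp add: card_insert_if)
  finally have "dim {a, b} < DIM('a)" using assms by simp
  then obtain z where z: "z \<noteq> 0" "\<And>y. y \<in> span {a, b} \<Longrightarrow> orthogonal z y"
    using orthogonal_to_subspace_exists by blast
  have "orthogonal z a" "orthogonal z b" by (auto intro!: z(2) span_base)
  then show ?thesis using z(1) by (intro that[of "sgn z"]) (auto simp: norm_sgn sgn_div_norm orthogonal_def)
qed


section \<open>Reflections and the inversion\<close>

lemma matrix_inv_inverse: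
  fixes A :: "'a::semiring_1^'n^'m"
  assumes "invertible A"
  shows "A ** matrix_inv A = mat 1" "matrix_inv A ** A = mat 1"
  using someI_ex[OF assms[unfolded invertible_def]] by (auto simp: matrix_inv_def)

definition reflection :: "'a::real_inner \<Rightarrow> 'a \<Rightarrow> 'a" where
  "reflection u h = h - (2 * (u \<bullet> h)) *\<^sub>R u"

lemma linear_reflection: "linear (reflection u)"
  by (rule linearI) (simp_all add: reflection_def algebra_simps)

lemma reflection_involutive: "norm u = 1 \<Longrightarrow> reflection u (reflection u h) = h"
  by (simp add: reflection_def inner_diff_right dot_square_norm algebra_simps)

lemma reflection_self_adjoint: "reflection u x \<bullet> y = x \<bullet> reflection u y"
  by (simp add: reflection_def algebra_simps inner_commute)

lemma reflection_orthogonal: "u \<bullet> h = 0 \<Longrightarrow> reflection u h = h"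
  by (simp add: reflection_def)

lemma inversion_has_derivative:
  fixes u :: "'a::real_inner"
  assumes "norm u = 1" "s > 0"
  shows "((\<lambda>y. (1 / (norm y)\<^sup>2) *\<^sub>R y) has_derivative (\<lambda>h. (1 / s\<^sup>2) *\<^sub>R reflection u h)) (at (s *\<^sub>R u))"
proof -
  have u: "u \<bullet> u = 1" using assms(1) by (simp add: dot_square_norm)
  have ne: "s *\<^sub>R u \<bullet> s *\<^sub>R u \<noteq> 0" using assms u by simp
  have ss: "s *\<^sub>R u \<bullet> s *\<^sub>R u = s\<^sup>2" by (simp add: u power2_eq_square)
  have "((\<lambda>y. y \<bullet> y) has_derivative (\<lambda>h. 2 * s * (u \<bullet> h))) (at (s *\<^sub>R u))"
    by (rule has_derivative_eq_rhs[OF has_derivative_inner[OF has_derivative_ident has_derivative_ident]])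
      (simp add: fun_eq_iff inner_commute[of _ u])
  from has_derivative_scaleR[OF Deriv.has_derivative_inverse[OF ne this] has_derivative_ident]
  have "((\<lambda>y. (1 / (y \<bullet> y)) *\<^sub>R y) has_derivative (\<lambda>h. (1 / s\<^sup>2) *\<^sub>R reflection u h)) (at (s *\<^sub>R u))"
    unfolding ss inverse_eq_divide
    by (rule has_derivative_eq_rhs)
      (use assms(2) in \<open>simp add: fun_eq_iff reflection_def scaleR_diff_right power2_eq_square\<close>)
  then show ?thesis by (simp add: dot_square_norm)
qed

lemma transition_has_derivative:
  assumes "norm u = 1" "s > 0"
  shows "(transition has_derivative (\<lambda>h. (1 / s\<^sup>2) *\<^sub>R reflection u h)) (at (s *\<^sub>R u))"
\<comment> \<open>\<open>transition\<close> is known to be the inversion only off the origin, hence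
  the transfer on an open set avoiding it.\<close>
proof (rule has_derivative_transform_within_open[OF inversion_has_derivative[OF assms], of "- {0}"])
  show "s *\<^sub>R u \<in> - {0}" using assms by auto
qed (auto simp: transition_eq)

context
  fixes u :: "real^6" and s :: real
  assumes u: "norm u = 1" and s: "s > 0"
begin

lemma jacobian_transition_mult:
  "jacobian transition (s *\<^sub>R u) *v h = (1 / s\<^sup>2) *\<^sub>R reflection u h"
proof -
  note d = transition_has_derivative[OF u s]
  show ?thesis
    unfolding jacobian_def frechet_derivative_at[OF d, symmetric]
    using matrix_vector_mul(2)[OF has_derivative_linear[OF d]] by metis
qed

lemma invertible_jacobian_transition: "invertible (jacobian transition (s *\<^sub>R u))"
  and matrix_inv_jacobian_transition_mult:
    "matrix_inv (jacobian transition (s *\<^sub>R u)) *v h = s\<^sup>2 *\<^sub>R reflection u h"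
proof -
  let ?D = "jacobian transition (s *\<^sub>R u)"
  \<comment> \<open>Since a reflection is its own inverse, only the scale factor of the Jacobian has
    to be inverted.\<close>
  define E where "E = matrix (\<lambda>h. s\<^sup>2 *\<^sub>R reflection u h)"
  have E: "E *v h = s\<^sup>2 *\<^sub>R reflection u h" for h
    unfolding E_def
    using matrix_vector_mul(2)[OF linear_compose_scale_right[OF linear_reflection]] by metis
  have "?D ** E = mat 1" "E ** ?D = mat 1"
    using s by (simp_all add: matrix_eq matrix_vector_mul_assoc[symmetric] E jacobian_transition_mult
        linear_scale[OF linear_reflection] reflection_involutive[OF u])
  then show "invertible ?D" unfolding invertible_def by blast
  then have "matrix_inv ?D = E"
    using \<open>?D ** E = mat 1\<close>
    by (metis matrix_inv_inverse(2) matrix_mul_assoc matrix_mul_lid matrix_mul_rid)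
  then show "matrix_inv ?D *v h = s\<^sup>2 *\<^sub>R reflection u h" by (simp add: E)
qed

lemma transpose_matrix_inv_jacobian_transition_mult:
  "transpose (matrix_inv (jacobian transition (s *\<^sub>R u))) *v h = s\<^sup>2 *\<^sub>R reflection u h"
proof -
  let ?M = "matrix_inv (jacobian transition (s *\<^sub>R u))"
  have "(transpose ?M *v h) \<bullet> x = (s\<^sup>2 *\<^sub>R reflection u h) \<bullet> x" for x
    by (simp add: dot_lmul_matrix matrix_inv_jacobian_transition_mult reflection_self_adjoint)
  then show ?thesis by (rule vector_eq_rdot[THEN iffD1, rule_format])
qed

end


section \<open>Blocks of the glued structure\<close>

lemma inv_frame_change:
  assumes "invertible (jacobian \<phi> y)"
  shows "inv (frame_change \<phi> y) (X, \<xi>) =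
    (matrix_inv (jacobian \<phi> y) *v X, transpose (jacobian \<phi> y) *v \<xi>)"
proof -
  let ?D = "jacobian \<phi> y"
  have D: "?D ** matrix_inv ?D = mat 1" "matrix_inv ?D ** ?D = mat 1"
    using assms by (simp_all add: matrix_inv_inverse)
  have T: "transpose ?D ** transpose (matrix_inv ?D) = mat 1"
    "transpose (matrix_inv ?D) ** transpose ?D = mat 1"
    using D by (simp_all add: matrix_transpose_mul[symmetric])
  have "inv (frame_change \<phi> y) =
      (\<lambda>(X, \<xi>). (matrix_inv ?D *v X, transpose ?D *v \<xi>))"
    by (rule inv_unique_comp)
      (auto simp: frame_change_def fun_eq_iff matrix_vector_mul_assoc D T
        simp del: transpose_matrix_vector)
  then show ?thesis by simp
qed

lemma fst_b_transform: "fst (b_transform B v) = fst v"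
  by (simp add: b_transform_def split_beta)

lemma b_transform_vertical: "b_transform B (0, \<xi>) = (0, \<xi>)"
  by (simp add: b_transform_def)

text \<open>The outer b-transform only alters the covector part. Passing to the
  \<open>x\<close>-frame scales vectors by \<open>1 / s\<^sup>2\<close> and covectors by
  \<open>s\<^sup>2\<close>, and returning scales the tangent part by \<open>s\<^sup>2\<close>: the
  factors cancel on \<open>H\<close> and give \<open>s ^ 4\<close> on \<alpha>.\<close>

lemma fst_glued:
  assumes "glued_by_b_field J_N b J_S" and J: "J_N (transition (s *\<^sub>R u)) = block_map H \<alpha> \<beta> K"
    and u: "norm u = 1" and s: "s > 0"
  shows "fst (J_S (s *\<^sub>R u) v) =
    reflection u (H *v reflection u (fst v) +
      s ^ 4 *\<^sub>R (\<alpha> *v reflection u (snd (b_transform (- b (s *\<^sub>R u)) v))))"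
proof -
  have "s *\<^sub>R u \<in> chart_S ` (U_N \<inter> U_S)" using u s by (auto simp: overlap_image)
  then have J_S: "J_S (s *\<^sub>R u) = b_transform (b (s *\<^sub>R u)) \<circ> transport transition J_N (s *\<^sub>R u)
      \<circ> b_transform (- b (s *\<^sub>R u))"
    using assms(1) by (auto simp: glued_by_b_field_def)
  obtain X \<xi> where v: "b_transform (- b (s *\<^sub>R u)) v = (X, \<xi>)" by fastforce
  have X: "X = fst v" using fst_b_transform v by (metis fst_conv)
  have "fst (J_S (s *\<^sub>R u) v) =
      s\<^sup>2 *\<^sub>R reflection u (H *v ((1 / s\<^sup>2) *\<^sub>R reflection u X) + \<alpha> *v (s\<^sup>2 *\<^sub>R reflection u \<xi>))"
    by (simp add: J_S fst_b_transform transport_def v J block_map_def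
        frame_change_def[THEN fun_cong]
        inv_frame_change[OF invertible_jacobian_transition[OF u s]]
        jacobian_transition_mult[OF u s] matrix_inv_jacobian_transition_mult[OF u s]
        transpose_matrix_inv_jacobian_transition_mult[OF u s] del: transpose_matrix_vector)
  also have "\<dots> = reflection u (H *v reflection u X + s ^ 4 *\<^sub>R (\<alpha> *v reflection u \<xi>))"
    using s by (simp add: linear_scale[OF linear_reflection] linear_add[OF linear_reflection]
        matrix_vector_mult_scaleR scaleR_add_right power_add[symmetric])
  finally show ?thesis by (simp add: X v)
qed

text \<open>An isometry squaring to -1 is skew for the pairing.\<close>

lemma strong_gacs_pairing_self:
  assumes "strong_gacs J"
  shows "pairing (J v) v = 0"
proof -
  have sq: "J (J v) = - v" and iso: "pairing (J (J v)) (J v) = pairing (J v) v"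
    using assms unfolding strong_gacs_def by blast+
  have "pairing (J (J v)) (J v) = - pairing (J v) v"
    unfolding sq by (simp add: pairing_def inner_commute)
  with iso have "pairing (J v) v = - pairing (J v) v" by simp
  then show ?thesis by simp
qed

text \<open>Write \<open>J (0, \<xi>) = (a, k)\<close>. Covectors are null, so
  \<open>a \<bullet> k = 0\<close>; applying the isometry \<open>J\<close> to
  \<open>J (a, 0)\<close> and \<open>(0, \<xi>)\<close> turns the claimed product into
  \<open>- (a \<bullet> k)\<close>.\<close>

lemma strong_gacs_H_alpha_skew:
  assumes "strong_gacs J"
  shows "fst (J (fst (J (0, \<xi>)), 0)) \<bullet> \<xi> = 0"
proof -
  obtain a k where ak: "J (0, \<xi>) = (a, k)" by fastforce
  have sq: "\<And>v. J (J v) = - v"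
    and iso: "\<And>v w. pairing (J v) (J w) = pairing v w"
    using assms by (auto simp: strong_gacs_def)
  have "a \<bullet> k = 0"
    using iso[of "(0, \<xi>)" "(0, \<xi>)"] by (simp add: pairing_def ak inner_commute)
  moreover have "pairing (J (J (a, 0))) (J (0, \<xi>)) = pairing (J (a, 0)) (0, \<xi>)" by (rule iso)
  ultimately show ?thesis by (simp add: sq pairing_def ak)
qed

text \<open>The upper left block of the square of \<open>J\<close> is
  \<open>H H + \<alpha> \<beta>\<close>, and here the second term vanishes.\<close>

lemma strong_gacs_tangent_square:
  assumes "strong_gacs J" and "\<And>\<xi>. fst (J (0, \<xi>)) = 0"
  shows "fst (J (fst (J (X, 0)), 0)) = - X"
proof -
  obtain p k where pk: "J (X, 0) = (p, k)" by fastforce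
  have "linear J" "J (J (X, 0)) = - (X, 0)" using assms(1) by (auto simp: strong_gacs_def)
  then have "J (p, 0) + J (0, k) = - (X, 0)" by (simp add: pk linear_add[symmetric])
  then have "fst (J (p, 0)) + fst (J (0, k)) = - X" by (metis fst_add fst_conv fst_uminus)
  then show ?thesis by (simp add: assms(2) pk)
qed

theorem corollary4p0p1:
  "\<not> (\<exists>J_N b J_S.
        locally_flat_model_on (chart_N ` U_N) J_N \<and>
        glued_by_b_field J_N b J_S \<and>
        smooth_strong_gacs_on (chart_S ` U_S) J_S)"
proof clarify
  fix J_N b J_S
  assume flat: "locally_flat_model_on (chart_N ` U_N) J_N"
    and glue: "glued_by_b_field J_N b J_S"
    and smooth: "smooth_strong_gacs_on (chart_S ` U_S) J_S"
  obtain H \<alpha> \<beta> K where J_N: "\<And>x. J_N x = block_map H \<alpha> \<beta> K"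
    using flat by (auto simp: locally_flat_model_on_def constant_blocks_on_def chart_N_image)
  have gacs_N: "strong_gacs (block_map H \<alpha> \<beta> K)"
    using flat J_N by (auto simp: locally_flat_model_on_def smooth_strong_gacs_on_def chart_N_image)
  have gacs_S: "strong_gacs (J_S y)" for y
    using smooth by (auto simp: smooth_strong_gacs_on_def chart_S_image)
  have cont: "continuous_on UNIV (\<lambda>y. J_S y v)" for v
    using smooth unfolding smooth_strong_gacs_on_def smooth_on_def chart_S_image
    by (metis Ck_on.simps(1))
  define P where "P X = fst (J_S 0 (X, 0))" for X
  \<comment> \<open>The limit is one-sided because the gluing formula is stated for
    \<open>s > 0\<close>. It does not depend on the direction \<open>u\<close>, so different
    reflections can be compared.\<close>
  have lim: "((\<lambda>s. fst (J_S (s *\<^sub>R u) v)) \<longlongrightarrow> fst (J_S 0 v)) (at_right 0)" for u v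
  proof -
    have "isCont (\<lambda>y. J_S y v) 0" using cont by (simp add: continuous_on_eq_continuous_at)
    moreover have "((\<lambda>s. s *\<^sub>R u) \<longlongrightarrow> 0) (at_right 0)" by (auto intro!: tendsto_eq_intros)
    ultimately show ?thesis using tendsto_fst[OF isCont_tendsto_compose] by fast
  qed
  have pos: "\<forall>\<^sub>F s in at_right (0::real). s > 0" by (simp add: eventually_at_right_less)
  note glued = fst_glued[OF glue J_N]

  \<comment> \<open>The b-transform fixes pure covectors, so the behaviour of \<open>b\<close> near
    the pole does not enter.\<close>
  have vertical: "fst (J_S 0 (0, \<xi>)) = 0" for \<xi>
  proof -
    obtain u :: "real^6" where u: "norm u = 1" using vector_choose_size[of 1] by auto
    have "\<forall>\<^sub>F s in at_right 0. fst (J_S (s *\<^sub>R u) (0, \<xi>)) = s ^ 4 *\<^sub>R reflection u (\<alpha> *v reflection u \<xi>)"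
      using pos
      by eventually_elim
        (simp add: glued[OF u] b_transform_vertical linear_scale[OF linear_reflection]
          linear_0[OF linear_reflection])
    moreover have "((\<lambda>s::real. s ^ 4 *\<^sub>R reflection u (\<alpha> *v reflection u \<xi>)) \<longlongrightarrow> 0) (at_right 0)"
      by (auto intro!: tendsto_eq_intros)
    ultimately have "((\<lambda>s. fst (J_S (s *\<^sub>R u) (0, \<xi>))) \<longlongrightarrow> 0) (at_right 0)"
      using tendsto_cong by fast
    then show ?thesis using tendsto_unique lim trivial_limit_at_right_real by blast
  qed
  have P_sq: "P (P X) = - X" for X
    unfolding P_def by (rule strong_gacs_tangent_square[OF gacs_S vertical])
  have J_S_lin: "linear (\<lambda>X. fst (J_S y (X, 0)))" for y
  proof -
    have "linear (J_S y)" using gacs_S by (simp add: strong_gacs_def)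
    from linear_compose[OF linear_compose[OF _ this] linear_fst, of "\<lambda>X. (X, 0)"]
    show ?thesis by (simp add: o_def linear_iff)
  qed
  then have P_lin: "linear P" by (simp add: P_def[abs_def])

  have skew: "P (reflection u (\<alpha> *v reflection u x)) \<bullet> x = 0" if u: "norm u = 1" for u x
  proof -
    let ?w = "reflection u (\<alpha> *v reflection u x)"
    have "\<forall>\<^sub>F s in at_right 0. fst (J_S (s *\<^sub>R u) (?w, 0)) \<bullet> x = 0"
      using pos
    proof eventually_elim
      case (elim s)
      have "fst (J_S (s *\<^sub>R u) (0, x)) = s ^ 4 *\<^sub>R ?w"
        using elim by (simp add: glued[OF u] b_transform_vertical
            linear_scale[OF linear_reflection] linear_0[OF linear_reflection])
      then have "fst (J_S (s *\<^sub>R u) (s ^ 4 *\<^sub>R ?w, 0)) \<bullet> x = 0"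
        using strong_gacs_H_alpha_skew[OF gacs_S] by metis
      then show ?case using elim linear_scale[OF J_S_lin, of "s *\<^sub>R u" "s ^ 4" ?w] by simp
    qed
    then have "((\<lambda>s. fst (J_S (s *\<^sub>R u) (?w, 0)) \<bullet> x) \<longlongrightarrow> 0) (at_right 0)"
      by (rule tendsto_eventually)
    moreover have "((\<lambda>s. fst (J_S (s *\<^sub>R u) (?w, 0)) \<bullet> x) \<longlongrightarrow> P ?w \<bullet> x) (at_right 0)"
      unfolding P_def by (intro tendsto_inner lim tendsto_const)
    ultimately show ?thesis using tendsto_unique trivial_limit_at_right_real by blast
  qed

  have \<alpha>0: "\<alpha> *v x = 0" for x
  proof (rule ccontr)
    define q where "q = \<alpha> *v x"
    assume "\<alpha> *v x \<noteq> 0"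
    then have q: "q \<noteq> 0" and x: "x \<noteq> 0" by (auto simp: q_def)
    have qx: "q \<bullet> x = 0"
      using strong_gacs_pairing_self[OF gacs_N, of "(0, x)"]
      by (simp add: pairing_def block_map_def q_def)
    \<comment> \<open>The inner reflection fixes \<open>x\<close>, and the outer one sends
      \<open>q\<close> to \<open>q - 2 (u \<bullet> q) u\<close>.\<close>
    have eq: "P q \<bullet> x = 2 * (u \<bullet> q) * (P u \<bullet> x)" if "norm u = 1" "u \<bullet> x = 0" for u
      using skew[OF that(1), of x] that(2)
      by (simp add: reflection_orthogonal q_def[symmetric])
        (simp add: reflection_def linear_diff[OF P_lin] linear_scale[OF P_lin] inner_diff_left)
    obtain u where u: "norm u = 1" "u \<bullet> x = 0" "u \<bullet> q = 0"
      by (rule exists_unit_orthogonal_to_pair[of x q]) simp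
    have Pq: "P q \<bullet> x = 0" using eq[OF u(1,2)] u(3) by simp
    have prod: "w \<bullet> q = 0 \<or> P w \<bullet> x = 0" if "w \<bullet> x = 0" for w
    proof (cases "w = 0")
      case False
      then show ?thesis
        using eq[of "sgn w"] that
        by (auto simp: Pq norm_sgn sgn_div_norm linear_scale[OF P_lin])
    qed simp
    \<comment> \<open>If \<open>w\<close> is orthogonal to \<open>q\<close>, then
      \<open>w + q\<close> is not, so \<open>prod\<close> kills
      \<open>P (w + q) \<bullet> x\<close>; as \<open>P q \<bullet> x = 0\<close>, the same holds
      for \<open>w\<close>.\<close>
    have "P w \<bullet> x = 0" if w: "w \<bullet> x = 0" for w
      using prod[OF w] prod[of "w + q"] w q
      by (auto simp: inner_add_left qx Pq linear_add[OF P_lin])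
    then show False
      using linear_complex_structure_no_invariant_hyperplane[OF P_lin P_sq] x by blast
  qed

  \<comment> \<open>With \<alpha> zero the term containing \<open>b\<close> disappears, so the
    expression is constant in \<open>s\<close>.\<close>
  have P_H: "P x = reflection u (H *v reflection u x)" if u: "norm u = 1" for u x
  proof -
    have "\<forall>\<^sub>F s in at_right 0. fst (J_S (s *\<^sub>R u) (x, 0)) = reflection u (H *v reflection u x)"
      using pos by eventually_elim (simp add: glued[OF u] \<alpha>0)
    then have "((\<lambda>s. fst (J_S (s *\<^sub>R u) (x, 0))) \<longlongrightarrow> reflection u (H *v reflection u x)) (at_right 0)"
      by (rule tendsto_eventually)
    then show ?thesis unfolding P_def using tendsto_unique lim trivial_limit_at_right_real by blast
  qed
  have H_sq: "H *v (H *v x) = - x" for x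
    using strong_gacs_tangent_square[OF gacs_N, of x] by (simp add: block_map_def \<alpha>0)

  obtain x :: "real^6" where x: "norm x = 1" using vector_choose_size[of 1] by auto
  obtain u where u: "norm u = 1" "u \<bullet> x = 0" "u \<bullet> (H *v x) = 0"
    by (rule exists_unit_orthogonal_to_pair[of x "H *v x"]) simp
  have Px: "P x = H *v x" using P_H[OF u(1), of x] u(2,3) by (simp add: reflection_orthogonal)
  define c where "c = x \<bullet> (H *v x)"
  \<comment> \<open>The part of \<open>H x\<close> orthogonal to \<open>x\<close>. Reflection in its
    direction fixes \<open>x\<close>, hence must also fix \<open>H x = P x\<close>, which makes
    \<open>w\<close> orthogonal to \<open>H x\<close> and therefore zero; so \<open>x\<close> is an
    eigenvector of \<open>H\<close>.\<close>
  define w where "w = H *v x - c *\<^sub>R x"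
  have xx: "x \<bullet> x = 1" using x by (simp add: dot_square_norm)
  have wx: "w \<bullet> x = 0" by (simp add: w_def c_def xx inner_diff_left inner_diff_right inner_commute)
  have "w = 0"
  proof (rule ccontr)
    assume w: "w \<noteq> 0"
    then have "norm (sgn w) = 1" by (simp add: norm_sgn)
    from P_H[OF this, of x] have "sgn w \<bullet> (H *v x) = 0"
      using w wx by (simp add: Px reflection_orthogonal sgn_div_norm) (simp add: reflection_def)
    then have "w \<bullet> (H *v x) = 0" using w by (simp add: sgn_div_norm)
    moreover have "w \<bullet> w = w \<bullet> (H *v x) - c * (w \<bullet> x)"
      by (subst (2) w_def) (simp add: inner_diff_right)
    ultimately show False using w wx by simp
  qed
  then have "x = 0"
    using linear_complex_structure_no_eigenvector[of "(*v) H" x c] H_sq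
    by (simp add: w_def matrix_vector_mul_linear)
  then show False using x by simp
qed

end
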